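(* For all graphs $G$ and $H$ (finite, simple, with at least one vertex), we have $$\gamma(G\square H)\ge c\,\gamma(G)\gamma(H),$$ where $c:=\frac{5+\sqrt{73}}{24}$.
   Context: All graphs are simple, finite and have at least one vertex. For a graph $G$, the closed neighborhood $N_G[v]$ of a vertex $v\in V(G)$ is the set consisting of $v$ and all its neighbors. The domination number $\gamma(G)$ is the minimum size of a set $D\subseteq V(G)$ such that $N_G[v]\cap D\neq\emptyset$ for every $v\in V(G)$. The Cartesian product $G\square H$ is the graph with vertex set $V(G)\times V(H)$ in which two distinct vertices $(g,h)$ and $(g',h')$ are adjacent if and only if either $gg'\in E(G)$ and $h=h'$, or $g=g'$ and $hh'\in E(H)$. *)

theory Defs
  imports Complex_Main "Graph_Theory.Pair_Digraph"
begin

text \<open>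
  A finite simple graph is a \<open>pair_graph\<close>: a finite loop-free digraph with symmetric arc relation
  and without parallel arcs, each edge being represented by its two opposite arcs.  The locale
  admits the graph without vertices, so nonemptiness of the vertex set is a separate hypothesis.
\<close>

definition closed_neighborhood :: "'a pair_pre_digraph \<Rightarrow> 'a \<Rightarrow> 'a set" where
  "closed_neighborhood G v = insert v {w. (v, w) \<in> parcs G}"

definition dominating_set :: "'a pair_pre_digraph \<Rightarrow> 'a set \<Rightarrow> bool" where
  "dominating_set G D \<longleftrightarrow>
     D \<subseteq> pverts G \<and> (\<forall>v\<in>pverts G. closed_neighborhood G v \<inter> D \<noteq> {})"

definition domination_number :: "'a pair_pre_digraph \<Rightarrow> nat" where
  "domination_number G = (LEAST k. \<exists>D. dominating_set G D \<and> card D = k)"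

definition cartesian_product ::
  "'a pair_pre_digraph \<Rightarrow> 'b pair_pre_digraph \<Rightarrow> ('a \<times> 'b) pair_pre_digraph" where
  "cartesian_product G H =
     \<lparr> pverts = pverts G \<times> pverts H,
       parcs = {((g, h), (g', h')) | g h g' h'.
         (g, h) \<in> pverts G \<times> pverts H \<and> (g', h') \<in> pverts G \<times> pverts H \<and>
         (g, h) \<noteq> (g', h') \<and>
         ((g, g') \<in> parcs G \<and> h = h' \<or> g = g' \<and> (h, h') \<in> parcs H)} \<rparr>"

lemma pair_graph_cartesian_product:
  assumes "pair_graph G" and "pair_graph H"
  shows "pair_graph (cartesian_product G H)"
proof -
  interpret G: pair_graph G by fact
  interpret H: pair_graph H by fact
  let ?P = "cartesian_product G H"
  have fin: "finite (pverts ?P)"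
    by (simp add: cartesian_product_def)
  have sub: "parcs ?P \<subseteq> pverts ?P \<times> pverts ?P"
    by (auto simp: cartesian_product_def)
  have fin_arcs: "finite (parcs ?P)"
    using finite_subset[OF sub] fin by blast
  have sym: "symmetric (with_proj ?P)"
    by (auto simp: symmetric_def cartesian_product_def
        intro!: symI dest: G.arcs_symmetric H.arcs_symmetric)
  have loopfree: "fst e \<noteq> snd e" if "e \<in> parcs ?P" for e
    using that by (auto simp: cartesian_product_def)
  show ?thesis
    using fin fin_arcs sub sym loopfree by unfold_locales auto
qed

end

theory Submission
  imports Defs
begin

text \<open>
  Let \<open>n\<close> and \<open>m\<close> be the domination numbers of \<open>G\<close> and \<open>H\<close>, and let \<open>D\<close> dominate the product.
  A vertex of the product may be dominated inside its row (a copy of \<open>G\<close>) or inside its column (a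
  copy of \<open>H\<close>).  Clark and Suen split \<open>V(G)\<close> into cells around a minimum dominating set \<open>U\<close> and
  observed two things.  The projection of \<open>D\<close> within a cell dominates all of \<open>H\<close> except for some
  rows, so projection and exceptional rows together are at least \<open>m\<close>; and in every row the elements
  of \<open>D\<close> can replace the centres of the cells that are exceptional there, so they are at least as
  numerous.  This gives \<open>2 |D| \<ge> n m\<close>.  Proposition \<open>weighted_clark_suen\<close> is the same argument with
  arbitrary vertex weights on both factors, for a dominating set \<open>U\<close> of minimum weight.  It is used
  with two choices of weights that pull in opposite directions.

  \<^item> Fix a row and give the elements of \<open>D\<close> in it weight \<open>0\<close>.  All vertices of \<open>G\<close> that they dominate
    become free, so if \<open>D\<close> is small, then a row that dominates much of \<open>D\<close> cannot be short.  Any two elements of \<open>D\<close> span a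
    vertex of the product lying in the row of one and the column of the other, and this vertex is
    dominated in that row or in that column.  Hence, on average over \<open>D\<close>, the rows or the columns
    dominate half of \<open>D\<close>, and \<open>pair_inequality\<close> says that the elements of \<open>D\<close> lie, on average, in
    long rows or long columns.
  \<^item> Make the vertices of \<open>G\<close> with long columns, and those of \<open>H\<close> with long rows, cheaper.  Then
    either the minimum-weight dominating sets contain many elements of \<open>D\<close> in their columns or rows,
    which the argument of Clark and Suen counts as a gain, or they do not, and then their weight is
    large although \<open>D\<close> is cheap.  In both cases \<open>balanced_inequality\<close> bounds the lengths from above.
    The two discounts must refer to each other: a column is measured by the discounted
    weights of its rows and conversely, and such weights are a fixed point of a monotone map.

  With \<open>x = |D| / (n m)\<close> the two bounds combine to \<open>9/2 x\<^sup>2 + x - 2 \<ge> 0\<close>, where the terms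
  that count, for each element of \<open>D\<close>, the product of the lengths of its row and its column enter in
  total with a favourable sign.  The inequality forces \<open>x \<ge> (sqrt 37 - 1) / 9\<close>, which is slightly more than
  \<open>(5 + sqrt 73) / 24\<close>.
\<close>

section \<open>Dominating sets\<close>

lemma domination_number_le:
  assumes "dominating_set G U"
  shows "domination_number G \<le> card U"
  unfolding domination_number_def using assms by (intro Least_le) blast

lemma dominating_set_pverts: "dominating_set G (pverts G)"
  by (auto simp: dominating_set_def closed_neighborhood_def)

lemma obtain_minimum_dominating_set:
  obtains U where "dominating_set G U" "card U = domination_number G"
proof -
  have "\<exists>k U. dominating_set G U \<and> card U = k"
    using dominating_set_pverts by blast
  from LeastI_ex[OF this] show ?thesis
    using that unfolding domination_number_def by blast
qed

lemma obtain_minimum_weight_dominating_set: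
  fixes w :: "'a \<Rightarrow> real"
  assumes "finite (pverts G)"
  obtains U where "dominating_set G U" "\<And>U'. dominating_set G U' \<Longrightarrow> sum w U \<le> sum w U'"
proof -
  let ?\<U> = "{U. dominating_set G U}"
  have "?\<U> \<subseteq> Pow (pverts G)"
    by (auto simp: dominating_set_def)
  then have "finite ?\<U>"
    using assms by (meson finite_Pow_iff finite_subset)
  moreover have "?\<U> \<noteq> {}"
    using dominating_set_pverts by blast
  ultimately obtain U where "is_arg_min (sum w) (\<lambda>U. U \<in> ?\<U>) U"
    using ex_is_arg_min_if_finite by blast
  then show ?thesis
    using that by (auto simp: is_arg_min_linorder)
qed

text \<open>
  Such a map \<open>\<sigma>\<close> is the assignment of the vertices to cells centred at the elements of \<open>U\<close>.  The set
  \<open>E\<close> collects preferred centres: they will be the ones of weight \<open>0\<close>.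
\<close>

lemma obtain_dominator:
  assumes U: "dominating_set G U" and "E \<subseteq> U"
  obtains \<sigma> where "\<And>g. g \<in> pverts G \<Longrightarrow> \<sigma> g \<in> closed_neighborhood G g \<inter> U"
    "\<And>u. u \<in> U \<Longrightarrow> \<sigma> u = u"
    "\<And>g. g \<notin> U \<Longrightarrow> closed_neighborhood G g \<inter> E \<noteq> {} \<Longrightarrow> \<sigma> g \<in> E"
proof -
  have "\<exists>u. (g \<in> pverts G \<longrightarrow> u \<in> closed_neighborhood G g \<inter> U) \<and> (g \<in> U \<longrightarrow> u = g) \<and>
      (g \<notin> U \<longrightarrow> closed_neighborhood G g \<inter> E \<noteq> {} \<longrightarrow> u \<in> E)" for g
  proof (cases "g \<in> U")
    case True
    then show ?thesis
      by (intro exI[of _ g]) (simp add: closed_neighborhood_def)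
  next
    case False
    show ?thesis
    proof (cases "closed_neighborhood G g \<inter> E = {}")
      case True
      then show ?thesis
        using False U by (auto simp: dominating_set_def)
    next
      case nonempty: False
      then show ?thesis
        using False \<open>E \<subseteq> U\<close> by blast
    qed
  qed
  then show ?thesis
    using that by metis
qed

lemma closed_neighborhood_refl [simp]: "v \<in> closed_neighborhood G v"
  by (simp add: closed_neighborhood_def)

text \<open>
  This form of domination in the product speaks of rows \<open>D\<inverse> `` {h}\<close> and columns \<open>D `` {g}\<close> only, so
  that exchanging the two factors amounts to taking the converse of \<open>D\<close>.
\<close>

definition product_dominating ::
    "'a pair_pre_digraph \<Rightarrow> 'b pair_pre_digraph \<Rightarrow> ('a \<times> 'b) set \<Rightarrow> bool" where
  "product_dominating G H D \<longleftrightarrow> D \<subseteq> pverts G \<times> pverts H \<and>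
     (\<forall>g\<in>pverts G. \<forall>h\<in>pverts H.
        closed_neighborhood G g \<inter> D\<inverse> `` {h} \<noteq> {} \<or> closed_neighborhood H h \<inter> D `` {g} \<noteq> {})"

lemma product_dominating_converse:
  "product_dominating G H D \<Longrightarrow> product_dominating H G (D\<inverse>)"
  unfolding product_dominating_def by auto

lemma product_dominating_if_dominating_set:
  assumes "dominating_set (cartesian_product G H) D"
  shows "product_dominating G H D"
proof -
  have sub: "D \<subseteq> pverts G \<times> pverts H"
    using assms by (simp add: dominating_set_def cartesian_product_def)
  have "closed_neighborhood G g \<inter> D\<inverse> `` {h} \<noteq> {} \<or> closed_neighborhood H h \<inter> D `` {g} \<noteq> {}"
    if "g \<in> pverts G" "h \<in> pverts H" for g h
  proof -
    have "(g, h) \<in> pverts (cartesian_product G H)"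
      using that by (simp add: cartesian_product_def)
    then obtain g' h' where "(g', h') \<in> D"
        "(g', h') \<in> closed_neighborhood (cartesian_product G H) (g, h)"
      using assms unfolding dominating_set_def by fast
    then show ?thesis
      by (auto simp: closed_neighborhood_def cartesian_product_def)
  qed
  with sub show ?thesis
    by (simp add: product_dominating_def)
qed

lemma sum_by_columns:
  assumes "finite A" "finite B" "D \<subseteq> A \<times> B"
  shows "(\<Sum>(g, h)\<in>D. f g h) = (\<Sum>g\<in>A. \<Sum>h\<in>D `` {g}. f g h)"
proof -
  have "D = Sigma A (\<lambda>g. D `` {g})"
    using assms(3) by auto
  then have "(\<Sum>(g, h)\<in>D. f g h) = (\<Sum>(g, h)\<in>Sigma A (\<lambda>g. D `` {g}). f g h)"
    by (rule arg_cong)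
  moreover have "finite (D `` {g})" for g
    using assms by (metis finite_Image finite_SigmaI finite_subset)
  ultimately show ?thesis
    using assms(1) by (simp add: sum.Sigma)
qed

lemma sum_converse: "(\<Sum>(h, g)\<in>D\<inverse>. f g h) = (\<Sum>(g, h)\<in>D. f g h)"
  by (rule sum.reindex_bij_witness[of _ prod.swap prod.swap]) auto

lemma sum_by_rows:
  assumes "finite A" "finite B" "D \<subseteq> A \<times> B"
  shows "(\<Sum>(g, h)\<in>D. f g h) = (\<Sum>h\<in>B. \<Sum>g\<in>D\<inverse> `` {h}. f g h)"
proof -
  have "D\<inverse> \<subseteq> B \<times> A"
    using assms(3) by auto
  from sum_by_columns[OF assms(2,1) this, of "\<lambda>h g. f g h"] show ?thesis
    by (simp add: sum_converse)
qed

section \<open>The argument of Clark and Suen with weights\<close>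

text \<open>
  The first summand on the right pays for the exceptional rows of the cells, by replacing, in each row,
  the centres of the cells exceptional there by the elements of \<open>D\<close> in this row.  Elements of \<open>D\<close> over
  \<open>U\<close> are already present after the exchange and cost nothing; for this the centre of a cell has to
  belong to its own cell.  The second summand pays for the projections of \<open>D\<close> within the cells.
\<close>

proposition weighted_clark_suen:
  fixes w :: "'a \<Rightarrow> real" and w' :: "'b \<Rightarrow> real"
  assumes G: "pair_graph G" and H: "pair_graph H" and D: "product_dominating G H D"
    and w: "\<And>g. 0 \<le> w g" and w': "\<And>h. 0 \<le> w' h"
    and U: "dominating_set G U" and U_min: "\<And>U'. dominating_set G U' \<Longrightarrow> sum w U \<le> sum w U'"
    and \<beta>: "\<And>V. dominating_set H V \<Longrightarrow> \<beta> \<le> sum w' V"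
    and \<sigma>: "\<And>g. g \<in> pverts G \<Longrightarrow> \<sigma> g \<in> closed_neighborhood G g \<inter> U" "\<And>u. u \<in> U \<Longrightarrow> \<sigma> u = u"
  shows "sum w U * \<beta> \<le> (\<Sum>(g, h)\<in>D. (if g \<in> U then 0 else w g * w' h) + w (\<sigma> g) * w' h)"
proof -
  interpret G: pair_graph G by fact
  interpret H: pair_graph H by fact
  note fins = G.pair_finite_verts H.pair_finite_verts
  have sub: "D \<subseteq> pverts G \<times> pverts H"
    using D by (simp add: product_dominating_def)
  have finD: "finite D"
    using sub fins by (meson finite_SigmaI finite_subset)
  have subU: "U \<subseteq> pverts G"
    using U by (simp add: dominating_set_def)
  then have finU: "finite U"
    using fins finite_subset by blast
  \<comment> \<open>\<open>P u\<close> is the projection of \<open>D\<close> within the cell of \<open>u\<close>, and \<open>S u\<close> the set of rows in which no vertex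
    of this cell is dominated within its column.\<close>
  define P where "P u = snd ` {z \<in> D. \<sigma> (fst z) = u}" for u
  define S where "S u = {h \<in> pverts H. closed_neighborhood H h \<inter> P u = {}}" for u
  have finP: "finite (P u)" and finS: "finite (S u)" for u
    using finD fins by (auto simp: P_def S_def)
  have cell: "\<beta> \<le> sum w' (P u) + sum w' (S u)" for u
  proof -
    have "dominating_set H (P u \<union> S u)"
    proof -
      have "P u \<subseteq> pverts H"
        using sub by (auto simp: P_def)
      moreover have "closed_neighborhood H h \<inter> (P u \<union> S u) \<noteq> {}" if "h \<in> pverts H" for h
      proof (cases "h \<in> S u")
        case True
        then show ?thesis
          using closed_neighborhood_refl[of h H] by blast
      next
        case False
        then show ?thesis
          using that by (auto simp: S_def)
      qed
      ultimately show ?thesis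
        by (auto simp: dominating_set_def S_def)
    qed
    then have "\<beta> \<le> sum w' (P u \<union> S u)"
      by (rule \<beta>)
    also have "\<dots> = sum w' (P u) + sum w' (S u)"
      using finP finS by (intro sum.union_disjoint) (auto simp: S_def closed_neighborhood_def)
    finally show ?thesis .
  qed
  have row: "sum w {u \<in> U. h \<in> S u} \<le> sum w (D\<inverse> `` {h} - U)" if h: "h \<in> pverts H" for h
  proof -
    let ?R = "{u \<in> U. h \<in> S u}" and ?E = "D\<inverse> `` {h}"
    have E: "?E \<subseteq> pverts G"
      using sub by auto
    \<comment> \<open>Vertices of an exceptional cell are dominated within the row, hence by \<open>?E\<close>; the others
      keep the centre of their cell.\<close>
    have "closed_neighborhood G g \<inter> ((U - ?R) \<union> ?E) \<noteq> {}" if g: "g \<in> pverts G" for g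
    proof (cases "\<sigma> g \<in> ?R")
      case True
      have "closed_neighborhood H h \<inter> D `` {g} \<subseteq> closed_neighborhood H h \<inter> P (\<sigma> g)"
        by (force simp: P_def)
      then have "closed_neighborhood H h \<inter> D `` {g} = {}"
        using True by (auto simp: S_def)
      then have "closed_neighborhood G g \<inter> ?E \<noteq> {}"
        using D g h unfolding product_dominating_def by blast
      then show ?thesis by blast
    next
      case False
      then show ?thesis
        using \<sigma>(1)[OF g] by blast
    qed
    then have "dominating_set G ((U - ?R) \<union> ?E)"
      using subU E by (auto simp: dominating_set_def)
    then have "sum w U \<le> sum w ((U - ?R) \<union> ?E)"
      by (rule U_min)
    also have "(U - ?R) \<union> ?E = (U - ?R) \<union> (?E - U)"
    proof -
      have "u \<notin> ?R" if "u \<in> ?E" "u \<in> U" for u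
      proof
        assume "u \<in> ?R"
        moreover have "h \<in> P u"
          using that \<sigma>(2)[of u] by (force simp: P_def)
        ultimately show False
          using closed_neighborhood_refl[of h H] unfolding S_def by blast
      qed
      then show ?thesis by blast
    qed
    also have "sum w \<dots> = sum w (U - ?R) + sum w (?E - U)"
      using finU E fins finite_subset by (intro sum.union_disjoint) blast+
    also have "sum w (U - ?R) = sum w U - sum w ?R"
      using finU by (intro sum_diff) auto
    finally show ?thesis by simp
  qed
  have "sum w U * \<beta> = (\<Sum>u\<in>U. w u * \<beta>)"
    by (rule sum_distrib_right)
  also have "\<dots> \<le> (\<Sum>u\<in>U. w u * sum w' (P u) + w u * sum w' (S u))"
    using cell w by (intro sum_mono) (metis distrib_left mult_left_mono)
  also have "\<dots> = (\<Sum>u\<in>U. w u * sum w' (P u)) + (\<Sum>u\<in>U. w u * sum w' (S u))"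
    by (rule sum.distrib)
  also have "(\<Sum>u\<in>U. w u * sum w' (P u)) \<le> (\<Sum>(g, h)\<in>D. w (\<sigma> g) * w' h)"
  proof -
    have "(\<Sum>u\<in>U. w u * sum w' (P u)) \<le> (\<Sum>u\<in>U. w u * (\<Sum>z\<in>{z \<in> D. \<sigma> (fst z) = u}. w' (snd z)))"
      unfolding P_def using w w' finD
      by (intro sum_mono mult_left_mono sum_image_le[where g = w' and f = snd, simplified comp_def]) auto
    also have "\<dots> = (\<Sum>u\<in>U. \<Sum>z\<in>{z \<in> D. \<sigma> (fst z) = u}. w (\<sigma> (fst z)) * w' (snd z))"
      by (simp add: sum_distrib_left)
    also have "\<dots> = (\<Sum>z\<in>D. w (\<sigma> (fst z)) * w' (snd z))"
      using sub \<sigma>(1) finD finU by (intro sum.group) auto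
    finally show ?thesis
      by (simp add: case_prod_beta)
  qed
  also have "(\<Sum>u\<in>U. w u * sum w' (S u)) \<le> (\<Sum>(g, h)\<in>D. if g \<in> U then 0 else w g * w' h)"
  proof -
    have "(\<Sum>u\<in>U. w u * sum w' (S u)) = (\<Sum>u\<in>U. \<Sum>h\<in>{h \<in> pverts H. h \<in> S u}. w u * w' h)"
      by (intro sum.cong) (auto simp: sum_distrib_left S_def intro!: sum.cong)
    also have "\<dots> = (\<Sum>h\<in>pverts H. \<Sum>u\<in>{u \<in> U. h \<in> S u}. w u * w' h)"
      using finU fins by (intro sum.swap_restrict)
    also have "\<dots> = (\<Sum>h\<in>pverts H. sum w {u \<in> U. h \<in> S u} * w' h)"
      by (simp add: sum_distrib_right)
    also have "\<dots> \<le> (\<Sum>h\<in>pverts H. sum w (D\<inverse> `` {h} - U) * w' h)"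
      using row w' by (intro sum_mono mult_right_mono)
    also have "\<dots> = (\<Sum>h\<in>pverts H. \<Sum>g\<in>D\<inverse> `` {h}. if g \<in> U then 0 else w g * w' h)"
    proof (intro sum.cong refl)
      fix h
      have "finite (D\<inverse> `` {h})"
        using finD by simp
      then show "sum w (D\<inverse> `` {h} - U) * w' h = (\<Sum>g\<in>D\<inverse> `` {h}. if g \<in> U then 0 else w g * w' h)"
        unfolding sum_distrib_right by (intro sum.mono_neutral_cong_left) auto
    qed
    also have "\<dots> = (\<Sum>(g, h)\<in>D. if g \<in> U then 0 else w g * w' h)"
      by (rule sum_by_rows[OF fins sub, symmetric])
    finally show ?thesis .
  qed
  finally show ?thesis
    by (simp add: case_prod_beta sum.distrib add.commute)
qed

section \<open>Rows of weight zero\<close>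

text \<open>
  With weight \<open>0\<close> on the row \<open>k\<close> and \<open>1\<close> elsewhere, a dominating set still weighs at least \<open>n\<close> minus the
  length of the row.  An element of \<open>D\<close> pays once unless its column meets the row \<open>k\<close>, and
  once more only if the row \<open>k\<close> fails to dominate its \<open>G\<close>-coordinate: otherwise this coordinate can be
  put into a cell whose centre has weight \<open>0\<close>.  The truncation by \<open>min n\<close> covers rows that are longer than \<open>n\<close>.
\<close>

lemma free_row_inequality:
  fixes D :: "('a \<times> 'b) set"
  assumes G: "pair_graph G" and H: "pair_graph H" and D: "product_dominating G H D"
  defines "n \<equiv> real (domination_number G)" and "m \<equiv> real (domination_number H)"
  shows "(n - min n (real (card (D\<inverse> `` {k})))) * m + (\<Sum>g\<in>D\<inverse> `` {k}. real (card (D `` {g})))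
    \<le> real (card D) + (\<Sum>(g, h)\<in>D. of_bool (closed_neighborhood G g \<inter> D\<inverse> `` {k} = {}))"
proof -
  interpret G: pair_graph G by fact
  interpret H: pair_graph H by fact
  note fins = G.pair_finite_verts H.pair_finite_verts
  have sub: "D \<subseteq> pverts G \<times> pverts H"
    using D by (simp add: product_dominating_def)
  have finD: "finite D"
    using sub fins by (meson finite_SigmaI finite_subset)
  define E where "E = D\<inverse> `` {k}"
  have E: "E \<subseteq> pverts G" "finite E"
    using sub finD by (auto simp: E_def)
  define w :: "'a \<Rightarrow> real" where "w g = of_bool (g \<notin> E)" for g
  obtain U0 where U0: "dominating_set G U0"
      and U0_min: "\<And>U'. dominating_set G U' \<Longrightarrow> sum w U0 \<le> sum w U'"
    using obtain_minimum_weight_dominating_set[OF fins(1)] by blast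
  define U where "U = U0 \<union> E"
  have U: "dominating_set G U"
    using U0 E by (auto simp: U_def dominating_set_def)
  have "U \<subseteq> pverts G"
    using U by (simp add: dominating_set_def)
  then have finU: "finite U"
    using fins finite_subset by blast
  have wU: "sum w U = sum w U0"
    using finU unfolding U_def by (intro sum.mono_neutral_right) (auto simp: w_def)
  have card_U: "sum w U = real (card (U - E))"
    using finU by (simp add: w_def of_bool_def sum.If_cases Int_def set_diff_eq)
  obtain \<sigma> where \<sigma>: "\<And>g. g \<in> pverts G \<Longrightarrow> \<sigma> g \<in> closed_neighborhood G g \<inter> U"
      "\<And>u. u \<in> U \<Longrightarrow> \<sigma> u = u"
    and \<sigma>_E: "\<And>g. g \<notin> U \<Longrightarrow> closed_neighborhood G g \<inter> E \<noteq> {} \<Longrightarrow> \<sigma> g \<in> E"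
    using obtain_dominator[OF U, of E] unfolding U_def by (metis Un_upper2)
  have "n \<le> real (card U)"
    using domination_number_le[OF U] by (simp add: n_def)
  also have "real (card U) = real (card (U - E)) + real (card E)"
    using finU E by (simp add: U_def card_Diff_subset card_mono)
  finally have "n - min n (real (card E)) \<le> sum w U"
    by (simp add: card_U)
  then have "(n - min n (real (card E))) * m \<le> sum w U * m"
    by (intro mult_right_mono) (auto simp: m_def)
  also have "sum w U * m \<le> (\<Sum>(g, h)\<in>D. (if g \<in> U then 0 else w g * 1) + w (\<sigma> g) * 1)"
  proof (rule weighted_clark_suen[OF G H D _ _ U])
    show "sum w U \<le> sum w U'" if "dominating_set G U'" for U'
      using U0_min[OF that] wU by simp
    show "m \<le> (\<Sum>h\<in>V. 1)" if "dominating_set H V" for V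
      using domination_number_le[OF that] by (simp add: m_def)
  qed (use \<sigma> in \<open>auto simp: w_def\<close>)
  \<comment> \<open>A vertex \<open>g\<close> of \<open>U\<close> is its own centre, but in exchange it is exempt from the first payment.\<close>
  also have "\<dots> \<le> (\<Sum>(g, h)\<in>D. of_bool (g \<notin> E) + of_bool (closed_neighborhood G g \<inter> E = {}))"
  proof (intro sum_mono, clarify)
    fix g h
    show "(if g \<in> U then 0 else w g * 1) + w (\<sigma> g) * 1
      \<le> of_bool (g \<notin> E) + of_bool (closed_neighborhood G g \<inter> E = {})"
      using \<sigma>_E[of g] \<sigma>(2)[of g]
      by (cases "g \<in> U") (auto simp: w_def)
  qed
  also have "\<dots> = (\<Sum>(g, h)\<in>D. of_bool (g \<notin> E)) + (\<Sum>(g, h)\<in>D. of_bool (closed_neighborhood G g \<inter> E = {}))"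
    by (simp add: case_prod_beta sum.distrib)
  also have "(\<Sum>(g, h)\<in>D. of_bool (g \<notin> E)) = real (card D) - (\<Sum>g\<in>E. real (card (D `` {g})))"
  proof -
    have "(\<Sum>(g, h)\<in>D. of_bool (g \<notin> E)) + (\<Sum>(g, h)\<in>D. of_bool (g \<in> E)) = (\<Sum>z\<in>D. 1 :: real)"
      unfolding sum.distrib[symmetric] case_prod_beta by (intro sum.cong) auto
    moreover have "(\<Sum>(g, h)\<in>D. of_bool (g \<in> E)) = (\<Sum>g\<in>pverts G. real (card (D `` {g})) * of_bool (g \<in> E))"
      using sum_by_columns[OF fins sub, of "\<lambda>g h. of_bool (g \<in> E) :: real"] by simp
    moreover have "\<dots> = (\<Sum>g\<in>E. real (card (D `` {g})))"
      using E fins by (intro sum.mono_neutral_cong_right) auto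
    ultimately show ?thesis by simp
  qed
  finally show ?thesis
    by (simp add: E_def)
qed

text \<open>
  Every row is used once for each element of \<open>D\<close> in it.  The elements whose columns meet the chosen row
  then add up to the sum of the products of column and row lengths.
\<close>

lemma sum_free_row_inequalities:
  fixes D :: "('a \<times> 'b) set"
  assumes G: "pair_graph G" and H: "pair_graph H" and D: "product_dominating G H D"
  defines "n \<equiv> real (domination_number G)" and "m \<equiv> real (domination_number H)"
  shows "(\<Sum>(g, h)\<in>D. (n - min n (real (card (D\<inverse> `` {h})))) * m)
      + (\<Sum>(g, h)\<in>D. real (card (D `` {g})) * real (card (D\<inverse> `` {h})))
    \<le> (real (card D))\<^sup>2
      + (\<Sum>z\<in>D. \<Sum>z'\<in>D. of_bool (closed_neighborhood G (fst z') \<inter> D\<inverse> `` {snd z} = {}))"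
proof -
  interpret G: pair_graph G by fact
  interpret H: pair_graph H by fact
  note fins = G.pair_finite_verts H.pair_finite_verts
  have sub: "D \<subseteq> pverts G \<times> pverts H"
    using D by (simp add: product_dominating_def)
  have "(\<Sum>(g', h)\<in>D. \<Sum>g\<in>D\<inverse> `` {h}. real (card (D `` {g})))
      = (\<Sum>(g, h)\<in>D. real (card (D `` {g})) * real (card (D\<inverse> `` {h})))"
    unfolding sum_by_rows[OF fins sub] by (simp add: sum_distrib_left mult.commute)
  moreover have "(\<Sum>(g', h)\<in>D. (n - min n (real (card (D\<inverse> `` {h})))) * m
        + (\<Sum>g\<in>D\<inverse> `` {h}. real (card (D `` {g}))))
      \<le> (\<Sum>(g', h)\<in>D. real (card D)
        + (\<Sum>z'\<in>D. of_bool (closed_neighborhood G (fst z') \<inter> D\<inverse> `` {h} = {})))"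
    using free_row_inequality[OF G H D]
    by (intro sum_mono) (auto simp: n_def m_def case_prod_beta)
  ultimately show ?thesis
    by (simp add: case_prod_beta sum.distrib power2_eq_square)
qed

text \<open>
  For elements \<open>z\<close> and \<open>z'\<close> of \<open>D\<close>, the vertex in the column of \<open>z'\<close> and the row of \<open>z\<close> is dominated
  within its row or within its column.  So among the \<open>|D|\<^sup>2\<close> pairs, each is counted as a failure at most
  once when the previous bound is applied to the rows and to the columns.
\<close>

proposition pair_inequality:
  fixes D :: "('a \<times> 'b) set"
  assumes G: "pair_graph G" and H: "pair_graph H" and D: "product_dominating G H D"
  defines "n \<equiv> real (domination_number G)" and "m \<equiv> real (domination_number H)"
  shows "(\<Sum>(g, h)\<in>D. (n - min n (real (card (D\<inverse> `` {h})))) * m + (m - min m (real (card (D `` {g})))) * n)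
      + 2 * (\<Sum>(g, h)\<in>D. real (card (D `` {g})) * real (card (D\<inverse> `` {h})))
    \<le> 3 * (real (card D))\<^sup>2"
proof -
  have sub: "D \<subseteq> pverts G \<times> pverts H"
    using D by (simp add: product_dominating_def)
  let ?L1 = "\<lambda>z z'. of_bool (closed_neighborhood G (fst z') \<inter> D\<inverse> `` {snd z} = {}) :: real"
  let ?L2 = "\<lambda>z z'. of_bool (closed_neighborhood H (snd z) \<inter> D `` {fst z'} = {}) :: real"
  let ?T = "\<Sum>(g, h)\<in>D. real (card (D `` {g})) * real (card (D\<inverse> `` {h}))"
  have rows: "(\<Sum>(g, h)\<in>D. (n - min n (real (card (D\<inverse> `` {h})))) * m) + ?T
      \<le> (real (card D))\<^sup>2 + (\<Sum>z\<in>D. \<Sum>z'\<in>D. ?L1 z z')"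
    using sum_free_row_inequalities[OF G H D] by (simp add: n_def m_def)
  have "(\<Sum>(h, g)\<in>D\<inverse>. (m - min m (real (card (D `` {g})))) * n)
      + (\<Sum>(h, g)\<in>D\<inverse>. real (card (D\<inverse> `` {h})) * real (card (D `` {g})))
      \<le> (real (card (D\<inverse>)))\<^sup>2
        + (\<Sum>z'\<in>D\<inverse>. \<Sum>z\<in>D\<inverse>. of_bool (closed_neighborhood H (fst z) \<inter> D `` {snd z'} = {}))"
    using sum_free_row_inequalities[OF H G product_dominating_converse[OF D]]
    by (simp add: n_def m_def)
  moreover have "(\<Sum>z'\<in>D\<inverse>. \<Sum>z\<in>D\<inverse>. of_bool (closed_neighborhood H (fst z) \<inter> D `` {snd z'} = {}))
      = (\<Sum>z'\<in>D. \<Sum>z\<in>D. ?L2 z z')"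
    by (intro sum.reindex_bij_witness[of _ prod.swap prod.swap]) auto
  moreover have "\<dots> = (\<Sum>z\<in>D. \<Sum>z'\<in>D. ?L2 z z')"
    by (rule sum.swap)
  ultimately have columns: "(\<Sum>(g, h)\<in>D. (m - min m (real (card (D `` {g})))) * n) + ?T
      \<le> (real (card D))\<^sup>2 + (\<Sum>z\<in>D. \<Sum>z'\<in>D. ?L2 z z')"
    by (simp add: sum_converse mult.commute)
  have "(\<Sum>z\<in>D. \<Sum>z'\<in>D. ?L1 z z') + (\<Sum>z\<in>D. \<Sum>z'\<in>D. ?L2 z z')
      = (\<Sum>z\<in>D. \<Sum>z'\<in>D. ?L1 z z' + ?L2 z z')"
    by (simp add: sum.distrib)
  also have "\<dots> \<le> (\<Sum>z\<in>D. \<Sum>z'\<in>D. 1)"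
  proof (intro sum_mono)
    fix z z' assume "z \<in> D" "z' \<in> D"
    then have "fst z' \<in> pverts G" "snd z \<in> pverts H"
      using sub by auto
    then have "closed_neighborhood G (fst z') \<inter> D\<inverse> `` {snd z} \<noteq> {} \<or> closed_neighborhood H (snd z) \<inter> D `` {fst z'} \<noteq> {}"
      using D by (simp add: product_dominating_def)
    then show "?L1 z z' + ?L2 z z' \<le> 1"
      by auto
  qed
  finally show ?thesis
    using rows columns by (simp add: case_prod_beta sum.distrib power2_eq_square)
qed

section \<open>Balanced weights\<close>

text \<open>
  The theorem of Knaster and Tarski for functions into the unit interval: the pointwise supremum of the
  post-fixed points is a fixed point.
\<close>

lemma monotone_unit_interval_fixpoint:
  fixes F :: "('a \<Rightarrow> real) \<Rightarrow> 'a \<Rightarrow> real"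
  assumes range: "\<And>w g. (\<And>g. 0 \<le> w g \<and> w g \<le> 1) \<Longrightarrow> 0 \<le> F w g \<and> F w g \<le> 1"
    and mono: "\<And>v w g. (\<And>g. v g \<le> w g) \<Longrightarrow> F v g \<le> F w g"
  obtains w where "\<And>g. 0 \<le> w g \<and> w g \<le> 1" "F w = w"
proof -
  define C where "C = {w. \<forall>g. 0 \<le> w g \<and> w g \<le> 1 \<and> w g \<le> F w g}"
  define W where "W g = (SUP w\<in>C. w g)" for g
  have zero: "(\<lambda>_. 0) \<in> C"
    using range[of "\<lambda>_. 0"] by (simp add: C_def)
  have bdd: "bdd_above ((\<lambda>w. w g) ` C)" for g
    by (rule bdd_aboveI[of _ 1]) (auto simp: C_def)
  have upper: "w g \<le> W g" if "w \<in> C" for w g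
    unfolding W_def using that bdd by (intro cSUP_upper)
  have unit: "0 \<le> W g \<and> W g \<le> 1" for g
  proof
    show "0 \<le> W g"
      using upper[OF zero] by simp
    show "W g \<le> 1"
      unfolding W_def
    proof (rule cSUP_least)
      show "C \<noteq> {}"
        using zero by blast
    qed (simp add: C_def)
  qed
  have post: "W g \<le> F W g" for g
    unfolding W_def
  proof (intro cSUP_least)
    fix w assume w: "w \<in> C"
    then have "w g \<le> F w g"
      by (simp add: C_def)
    also have "\<dots> \<le> F W g"
      using upper[OF w] by (intro mono)
    finally show "w g \<le> F (\<lambda>g. SUP w\<in>C. w g) g"
      by (simp add: W_def[abs_def])
  qed (use zero in blast)
  have "F W \<in> C"
    using range[OF unit] mono[OF post] by (simp add: C_def)
  then have "F W = W"
    using upper post by (intro ext antisym)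
  then show ?thesis
    using that unit by blast
qed

text \<open>
  The discount on \<open>g\<close> is proportional to the weight of its column.  The slope \<open>1/2\<close> is what lets the
  loss in the weight of a dominating set cancel against the overlap with \<open>D\<close> in
  \<open>balanced_inequality\<close>; the truncation keeps the weights nonnegative.
\<close>

definition discounted :: "('a \<times> 'b) set \<Rightarrow> real \<Rightarrow> ('b \<Rightarrow> real) \<Rightarrow> 'a \<Rightarrow> real" where
  "discounted D m w' g = 1 - min 1 (sum w' (D `` {g}) / m) / 2"

lemma discounted_bounds:
  assumes "0 < m" "\<And>h. 0 \<le> w' h"
  shows "0 \<le> discounted D m w' g" "discounted D m w' g \<le> 1"
proof -
  have "0 \<le> sum w' (D `` {g}) / m"
    using assms by (simp add: sum_nonneg)
  then show "0 \<le> discounted D m w' g" "discounted D m w' g \<le> 1"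
    by (auto simp: discounted_def min_def)
qed

lemma discounted_antimono:
  assumes "0 < m" "\<And>h. v h \<le> w h"
  shows "discounted D m w g \<le> discounted D m v g"
proof -
  have "sum v (D `` {g}) / m \<le> sum w (D `` {g}) / m"
    using assms by (intro divide_right_mono sum_mono) auto
  then show ?thesis
    by (simp add: discounted_def min_def)
qed

text \<open>
  Discounting reverses the order, so discounting twice is monotone and has a fixed point.
\<close>

lemma obtain_balanced_weights:
  fixes D :: "('a \<times> 'b) set"
  assumes "0 < n" "0 < m"
  obtains w w' where "w = discounted D m w'" "w' = discounted (D\<inverse>) n w"
    "\<And>g. 0 \<le> w g \<and> w g \<le> 1" "\<And>h. 0 \<le> w' h \<and> w' h \<le> 1"
proof -
  have "0 \<le> discounted D m (discounted (D\<inverse>) n w) g \<and> discounted D m (discounted (D\<inverse>) n w) g \<le> 1"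
    if "\<And>g. 0 \<le> w g \<and> w g \<le> 1" for w g
    using that assms by (simp add: discounted_bounds)
  moreover have "discounted D m (discounted (D\<inverse>) n v) g \<le> discounted D m (discounted (D\<inverse>) n w) g"
    if "\<And>g. v g \<le> w g" for v w g
    using that assms by (intro discounted_antimono)
  ultimately obtain w where "\<And>g. 0 \<le> w g \<and> w g \<le> 1" "discounted D m (discounted (D\<inverse>) n w) = w"
    using monotone_unit_interval_fixpoint[of "\<lambda>w. discounted D m (discounted (D\<inverse>) n w)"] by blast
  then show ?thesis
    using that[of w "discounted (D\<inverse>) n w"] assms by (simp add: discounted_bounds)
qed

text \<open>
  Here the weight of the centre of a cell is estimated by \<open>1\<close>, except for elements of \<open>D\<close> over \<open>U\<close>: each
  of them pays only once, which makes the weight of \<open>D\<close> over \<open>U\<close> a gain.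
\<close>

lemma overlap_inequality:
  fixes w :: "'a \<Rightarrow> real" and w' :: "'b \<Rightarrow> real"
  assumes G: "pair_graph G" and H: "pair_graph H" and D: "product_dominating G H D"
    and w: "\<And>g. 0 \<le> w g \<and> w g \<le> 1" and w': "\<And>h. 0 \<le> w' h"
    and U: "dominating_set G U" and U_min: "\<And>U'. dominating_set G U' \<Longrightarrow> sum w U \<le> sum w U'"
    and V_min: "\<And>V'. dominating_set H V' \<Longrightarrow> sum w' V \<le> sum w' V'"
  shows "sum w U * sum w' V + (\<Sum>u\<in>U. sum w' (D `` {u})) \<le> (\<Sum>(g, h)\<in>D. w g * w' h + w' h)"
proof -
  interpret G: pair_graph G by fact
  interpret H: pair_graph H by fact
  note fins = G.pair_finite_verts H.pair_finite_verts
  have sub: "D \<subseteq> pverts G \<times> pverts H"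
    using D by (simp add: product_dominating_def)
  obtain \<sigma> where \<sigma>: "\<And>g. g \<in> pverts G \<Longrightarrow> \<sigma> g \<in> closed_neighborhood G g \<inter> U"
      "\<And>u. u \<in> U \<Longrightarrow> \<sigma> u = u"
    using obtain_dominator[OF U empty_subsetI] by metis
  have "sum w U * sum w' V \<le> (\<Sum>(g, h)\<in>D. (if g \<in> U then 0 else w g * w' h) + w (\<sigma> g) * w' h)"
    using w by (intro weighted_clark_suen[OF G H D _ w' U U_min V_min \<sigma>]) simp_all
  also have "\<dots> \<le> (\<Sum>(g, h)\<in>D. (w g * w' h + w' h) - of_bool (g \<in> U) * w' h)"
  proof (intro sum_mono, clarify)
    fix g h
    have "w (\<sigma> g) * w' h \<le> w' h"
      using w w' by (simp add: mult_left_le_one_le)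
    then show "(if g \<in> U then 0 else w g * w' h) + w (\<sigma> g) * w' h
      \<le> (w g * w' h + w' h) - of_bool (g \<in> U) * w' h"
      using \<sigma>(2)[of g] by auto
  qed
  also have "\<dots> = (\<Sum>(g, h)\<in>D. w g * w' h + w' h) - (\<Sum>(g, h)\<in>D. of_bool (g \<in> U) * w' h)"
    by (simp add: case_prod_beta sum_subtractf)
  also have "(\<Sum>(g, h)\<in>D. of_bool (g \<in> U) * w' h) = (\<Sum>g\<in>pverts G. of_bool (g \<in> U) * sum w' (D `` {g}))"
    unfolding sum_by_columns[OF fins sub] by (simp add: sum_distrib_left)
  also have "\<dots> = (\<Sum>u\<in>U. sum w' (D `` {u}))"
    using U fins by (intro sum.mono_neutral_cong_right) (auto simp: dominating_set_def)
  finally show ?thesis by simp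
qed

text \<open>
  The only way for a set to be light for its size is to have much of \<open>D\<close> over it.
\<close>

lemma discounted_weight_bound:
  assumes "0 < m"
  shows "real (card U) - (\<Sum>u\<in>U. sum w' (D `` {u})) / (2 * m) \<le> sum (discounted D m w') U"
proof -
  have "(\<Sum>u\<in>U. 1 - sum w' (D `` {u}) / (2 * m)) \<le> sum (discounted D m w') U"
    by (intro sum_mono) (simp add: discounted_def)
  then show ?thesis
    by (simp add: sum_subtractf sum_divide_distrib)
qed

text \<open>
  Let \<open>p\<close> and \<open>q\<close> be the minimum weights of dominating sets of \<open>G\<close> and \<open>H\<close>.  The overlap of \<open>D\<close> with the
  minimizers is at least \<open>2 m (n - p)\<close> and \<open>2 n (m - q)\<close>, so the two overlap
  inequalities add up to at least \<open>2 p q + 2 m (n - p) + 2 n (m - q) = 2 n m + 2 (n - p) (m - q)\<close>.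
  The overlap over a set is measured by exactly the quantity that determines its discount; this is why
  the weights on \<open>G\<close> and on \<open>H\<close> have to be defined by each other.
\<close>

proposition balanced_inequality:
  fixes D :: "('a \<times> 'b) set"
  assumes G: "pair_graph G" and H: "pair_graph H" and D: "product_dominating G H D"
  defines "n \<equiv> real (domination_number G)" and "m \<equiv> real (domination_number H)"
  assumes pos: "0 < n" "0 < m"
    and w_def: "w = discounted D m w'" and w'_def: "w' = discounted (D\<inverse>) n w"
    and w: "\<And>g. 0 \<le> w g \<and> w g \<le> 1" and w': "\<And>h. 0 \<le> w' h \<and> w' h \<le> 1"
  shows "2 * n * m \<le> (\<Sum>(g, h)\<in>D. 2 * (w g * w' h) + w g + w' h)"
proof -
  interpret G: pair_graph G by fact
  interpret H: pair_graph H by fact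
  obtain U where U: "dominating_set G U" "\<And>U'. dominating_set G U' \<Longrightarrow> sum w U \<le> sum w U'"
    using obtain_minimum_weight_dominating_set[OF G.pair_finite_verts] by blast
  obtain V where V: "dominating_set H V" "\<And>V'. dominating_set H V' \<Longrightarrow> sum w' V \<le> sum w' V'"
    using obtain_minimum_weight_dominating_set[OF H.pair_finite_verts] by blast
  define a where "a = (\<Sum>u\<in>U. sum w' (D `` {u}))"
  define b where "b = (\<Sum>v\<in>V. sum w (D\<inverse> `` {v}))"
  define p where "p = sum w U"
  define q where "q = sum w' V"
  have rows: "p * q + a \<le> (\<Sum>(g, h)\<in>D. w g * w' h + w' h)"
    unfolding p_def q_def a_def using w w' U V by (intro overlap_inequality[OF G H D]) auto
  have "q * p + b \<le> (\<Sum>(h, g)\<in>D\<inverse>. w' h * w g + w g)"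
    unfolding p_def q_def b_def using w w' U V
    by (intro overlap_inequality[OF H G product_dominating_converse[OF D]]) auto
  then have columns: "q * p + b \<le> (\<Sum>(g, h)\<in>D. w' h * w g + w g)"
    by (simp add: sum_converse)
  have "n \<le> real (card U)" "m \<le> real (card V)"
    using domination_number_le U V by (auto simp: n_def m_def)
  then have "n - a / (2 * m) \<le> p" "m - b / (2 * n) \<le> q"
    using discounted_weight_bound[of m U w' D] discounted_weight_bound[of n V w "D\<inverse>"] pos
    unfolding a_def b_def p_def q_def w_def[symmetric] w'_def[symmetric] by linarith+
  then have a: "2 * m * (n - p) \<le> a" and b: "2 * n * (m - q) \<le> b"
    using pos by (simp_all add: field_simps)
  obtain U1 where U1: "dominating_set G U1" "card U1 = domination_number G"
    by (rule obtain_minimum_dominating_set)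
  have "p \<le> sum w U1"
    using U U1 by (simp add: p_def)
  also have "\<dots> \<le> n"
    using sum_bounded_above[of U1 w 1] w U1 by (simp add: n_def)
  finally have p: "p \<le> n" .
  obtain V1 where V1: "dominating_set H V1" "card V1 = domination_number H"
    by (rule obtain_minimum_dominating_set)
  have "q \<le> sum w' V1"
    using V V1 by (simp add: q_def)
  also have "\<dots> \<le> m"
    using sum_bounded_above[of V1 w' 1] w' V1 by (simp add: m_def)
  finally have q: "q \<le> m" .
  have "0 \<le> (n - p) * (m - q)"
    using p q by simp
  then have "2 * n * m \<le> 2 * (p * q) + a + b"
    using a b by (simp add: algebra_simps)
  also have "\<dots> \<le> (\<Sum>(g, h)\<in>D. w g * w' h + w' h) + (\<Sum>(g, h)\<in>D. w' h * w g + w g)"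
    using rows columns by (simp add: mult.commute)
  also have "\<dots> = (\<Sum>(g, h)\<in>D. 2 * (w g * w' h) + w g + w' h)"
    unfolding sum.distrib[symmetric] by (intro sum.cong) auto
  finally show ?thesis .
qed

text \<open>
  Balanced weights measure a column by discounted rows and thus underestimate its length, whereas
  the inequality for pairs involves the lengths themselves.  In relative terms, the error is at most half of
  the sum of the row lengths along the column.
\<close>

lemma discount_deficit:
  fixes D :: "('a \<times> 'b) set"
  assumes fin: "finite A" "finite B" and sub: "D \<subseteq> A \<times> B" and pos: "0 < n" "0 < m"
    and w_def: "w = discounted D m w'" and w'_def: "w' = discounted (D\<inverse>) n w"
    and w: "\<And>g. 0 \<le> w g \<and> w g \<le> 1"
  shows "(\<Sum>(g, h)\<in>D. min 1 (real (card (D `` {g})) / m))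
    \<le> (\<Sum>(g, h)\<in>D. 2 * (1 - w g))
      + (\<Sum>(g, h)\<in>D. real (card (D `` {g})) * real (card (D\<inverse> `` {h}))) / (2 * n * m)"
proof -
  have pointwise: "min 1 (real (card (D `` {g})) / m)
      \<le> 2 * (1 - w g) + (\<Sum>h\<in>D `` {g}. real (card (D\<inverse> `` {h}))) / (2 * n * m)" for g
  proof -
    have "1 - w' h \<le> real (card (D\<inverse> `` {h})) / (2 * n)" for h
    proof -
      have "sum w (D\<inverse> `` {h}) / n \<le> real (card (D\<inverse> `` {h})) / n"
        using sum_bounded_above[of "D\<inverse> `` {h}" w 1] w pos by (simp add: divide_right_mono)
      moreover have "1 - w' h \<le> (sum w (D\<inverse> `` {h}) / n) / 2"
        unfolding w'_def discounted_def by simp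
      ultimately show ?thesis by simp
    qed
    then have "(\<Sum>h\<in>D `` {g}. 1 - w' h) \<le> (\<Sum>h\<in>D `` {g}. real (card (D\<inverse> `` {h})) / (2 * n))"
      by (intro sum_mono)
    then have "real (card (D `` {g})) - sum w' (D `` {g})
        \<le> (\<Sum>h\<in>D `` {g}. real (card (D\<inverse> `` {h}))) / (2 * n)"
      by (simp add: sum_subtractf sum_divide_distrib)
    then have "(real (card (D `` {g})) - sum w' (D `` {g})) / m
        \<le> (\<Sum>h\<in>D `` {g}. real (card (D\<inverse> `` {h}))) / (2 * n) / m"
      using pos by (intro divide_right_mono) auto
    then have "real (card (D `` {g})) / m
        \<le> sum w' (D `` {g}) / m + (\<Sum>h\<in>D `` {g}. real (card (D\<inverse> `` {h}))) / (2 * n * m)"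
      by (simp add: diff_divide_distrib)
    moreover have "0 \<le> (\<Sum>h\<in>D `` {g}. real (card (D\<inverse> `` {h}))) / (2 * n * m)"
      using pos by (simp add: sum_nonneg)
    moreover have "2 * (1 - w g) = min 1 (sum w' (D `` {g}) / m)"
      unfolding w_def discounted_def by simp
    ultimately show ?thesis by linarith
  qed
  have "(\<Sum>(g, h)\<in>D. min 1 (real (card (D `` {g})) / m))
      \<le> (\<Sum>(g, k)\<in>D. 2 * (1 - w g) + (\<Sum>h\<in>D `` {g}. real (card (D\<inverse> `` {h}))) / (2 * n * m))"
    using pointwise by (intro sum_mono) auto
  also have "\<dots> = (\<Sum>(g, h)\<in>D. 2 * (1 - w g))
      + (\<Sum>(g, k)\<in>D. \<Sum>h\<in>D `` {g}. real (card (D\<inverse> `` {h}))) / (2 * n * m)"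
    by (simp add: case_prod_beta sum.distrib sum_divide_distrib)
  also have "(\<Sum>(g, k)\<in>D. \<Sum>h\<in>D `` {g}. real (card (D\<inverse> `` {h})))
      = (\<Sum>(g, h)\<in>D. real (card (D `` {g})) * real (card (D\<inverse> `` {h})))"
    unfolding sum_by_columns[OF fin sub] by (simp add: sum_distrib_left)
  finally show ?thesis .
qed

section \<open>Combining the two inequalities\<close>

text \<open>
  The number \<open>c = (5 + sqrt 73) / 24\<close> is a root of \<open>12 c\<^sup>2 = 5 c + 1\<close>, so the quadratic polynomial has the
  value \<open>(23 c - 13) / 8\<close> at \<open>c\<close>, which is negative.
\<close>

lemma constant_le_if_quadratic_nonneg:
  fixes x :: real
  assumes "0 \<le> x" "0 \<le> 9 / 2 * x\<^sup>2 + x - 2"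
  shows "(5 + sqrt 73) / 24 \<le> x"
proof (rule ccontr)
  define c where "c = (5 + sqrt 73) / 24"
  assume "\<not> ?thesis"
  then have "x < c"
    by (simp add: c_def)
  have "sqrt 73 * sqrt 73 = 73"
    by simp
  then have c2: "12 * c\<^sup>2 = 5 * c + 1"
    by (simp add: c_def power2_eq_square field_simps)
  have "sqrt 73 < 214 / 25"
    by (intro real_less_lsqrt) (auto simp: power2_eq_square)
  then have "c < 13 / 23"
    by (simp add: c_def)
  have "x\<^sup>2 \<le> c\<^sup>2"
    using \<open>x < c\<close> assms(1) by (intro power_mono) auto
  then show False
    using assms(2) c2 \<open>c < 13 / 23\<close> \<open>x < c\<close> by linarith
qed

lemma card_product_dominating_ge:
  fixes D :: "('a \<times> 'b) set"
  assumes G: "pair_graph G" and H: "pair_graph H" and D: "product_dominating G H D"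
  defines "n \<equiv> real (domination_number G)" and "m \<equiv> real (domination_number H)"
  shows "(5 + sqrt 73) / 24 * n * m \<le> real (card D)"
proof (cases "n * m = 0")
  case True
  then show ?thesis by auto
next
  case False
  then have pos: "0 < n" "0 < m"
    by (auto simp: n_def m_def)
  interpret G: pair_graph G by fact
  interpret H: pair_graph H by fact
  note fins = G.pair_finite_verts H.pair_finite_verts
  have sub: "D \<subseteq> pverts G \<times> pverts H"
    using D by (simp add: product_dominating_def)
  \<comment> \<open>\<open>d\<close> and \<open>e\<close> are the lengths of columns and rows; \<open>X\<close> and \<open>Y\<close> sum the truncated relative lengths,
    which the inequality for pairs bounds from below and the balanced weights bound from above.\<close>
  define d e where "d g = real (card (D `` {g}))" and "e h = real (card (D\<inverse> `` {h}))" for g h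
  define N T where "N = real (card D)" and "T = (\<Sum>(g, h)\<in>D. d g * e h)"
  define X Y where "X = (\<Sum>(g, h)\<in>D. min 1 (d g / m))" and "Y = (\<Sum>(g, h)\<in>D. min 1 (e h / n))"
  define t where "t = T / (n * m)"
  have T_nonneg: "0 \<le> T"
    by (auto simp: T_def d_def e_def intro!: sum_nonneg)
  have pair: "2 * N * (n * m) - (n * m) * (X + Y) + 2 * T \<le> 3 * N\<^sup>2"
  proof -
    have scale: "min n y = n * min 1 (y / n)" "min m y = m * min 1 (y / m)" for y
      using pos by (auto simp: min_def field_simps)
    have "(\<Sum>(g, h)\<in>D. (n - min n (e h)) * m + (m - min m (d g)) * n)
        = (\<Sum>(g, h)\<in>D. 2 * (n * m) - (n * m) * (min 1 (d g / m) + min 1 (e h / n)))"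
      unfolding scale by (intro sum.cong) (auto simp: algebra_simps)
    also have "\<dots> = 2 * N * (n * m) - (n * m) * (X + Y)"
      by (simp add: N_def X_def Y_def case_prod_beta sum_subtractf sum.distrib sum_distrib_left distrib_left)
    finally show ?thesis
      using pair_inequality[OF G H D] by (simp add: n_def m_def N_def T_def d_def e_def)
  qed
  obtain w w' where w_def: "w = discounted D m w'" and w'_def: "w' = discounted (D\<inverse>) n w"
    and w: "\<And>g. 0 \<le> w g \<and> w g \<le> 1" and w': "\<And>h. 0 \<le> w' h \<and> w' h \<le> 1"
    using obtain_balanced_weights[OF pos] by blast
  \<comment> \<open>Undoing the factor \<open>1/2\<close> of the discount: \<open>r g\<close> is the truncated relative weight of the column.\<close>
  define r r' where "r g = 2 * (1 - w g)" and "r' h = 2 * (1 - w' h)" for g h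
  define R Q where "R = (\<Sum>(g, h)\<in>D. r g + r' h)" and "Q = (\<Sum>(g, h)\<in>D. r g * r' h)"
  have "X \<le> (\<Sum>(g, h)\<in>D. r g) + T / (2 * n * m)"
    using discount_deficit[OF fins sub pos w_def w'_def w]
    by (simp add: X_def T_def r_def d_def e_def)
  moreover have "Y \<le> (\<Sum>(g, h)\<in>D. r' h) + T / (2 * m * n)"
  proof -
    have "D\<inverse> \<subseteq> pverts H \<times> pverts G"
      using sub by auto
    from discount_deficit[OF fins(2,1) this pos(2,1) w'_def _ w', unfolded converse_converse, OF w_def]
    have "(\<Sum>(h, g)\<in>D\<inverse>. min 1 (e h / n)) \<le> (\<Sum>(h, g)\<in>D\<inverse>. r' h) + (\<Sum>(h, g)\<in>D\<inverse>. e h * d g) / (2 * m * n)"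
      by (simp add: r'_def d_def e_def)
    then show ?thesis
      by (simp add: sum_converse Y_def T_def mult.commute)
  qed
  moreover have "T / (2 * n * m) + T / (2 * m * n) = t"
    using pos by (simp add: t_def field_simps)
  moreover have "R = (\<Sum>(g, h)\<in>D. r g) + (\<Sum>(g, h)\<in>D. r' h)"
    by (simp add: R_def case_prod_beta sum.distrib)
  ultimately have deficit: "X + Y \<le> R + t"
    by linarith
  have r: "0 \<le> r g" "r g \<le> d g / m" for g
  proof -
    show "0 \<le> r g"
      using w by (simp add: r_def)
    have "r g \<le> sum w' (D `` {g}) / m"
      unfolding r_def w_def discounted_def by simp
    also have "\<dots> \<le> d g / m"
      using sum_bounded_above[of "D `` {g}" w' 1] w' pos by (simp add: d_def divide_right_mono)
    finally show "r g \<le> d g / m" .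
  qed
  have r': "0 \<le> r' h" "r' h \<le> e h / n" for h
  proof -
    show "0 \<le> r' h"
      using w' by (simp add: r'_def)
    have "r' h \<le> sum w (D\<inverse> `` {h}) / n"
      unfolding r'_def w'_def discounted_def by simp
    also have "\<dots> \<le> e h / n"
      using sum_bounded_above[of "D\<inverse> `` {h}" w 1] w pos by (simp add: e_def divide_right_mono)
    finally show "r' h \<le> e h / n" .
  qed
  have "Q \<le> (\<Sum>(g, h)\<in>D. d g / m * (e h / n))"
    unfolding Q_def
  proof (intro sum_mono, clarify)
    fix g h
    show "r g * r' h \<le> d g / m * (e h / n)"
      using r[of g] r'[of h] by (intro mult_mono) linarith+
  qed
  also have "\<dots> = t"
    by (simp add: t_def T_def sum_divide_distrib case_prod_beta mult.commute)
  finally have product: "Q \<le> t" .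
  have "2 * n * m \<le> (\<Sum>(g, h)\<in>D. 2 * (w g * w' h) + w g + w' h)"
    using balanced_inequality[OF G H D] pos w_def w'_def w w' by (simp add: n_def m_def)
  also have "\<dots> = (\<Sum>(g, h)\<in>D. 4 - 3 / 2 * (r g + r' h) + 1 / 2 * (r g * r' h))"
    by (intro sum.cong) (auto simp: r_def r'_def algebra_simps)
  also have "\<dots> = 4 * N - 3 / 2 * R + 1 / 2 * Q"
    unfolding case_prod_beta sum.distrib sum_subtractf sum_distrib_left[symmetric]
    by (simp add: N_def R_def Q_def case_prod_beta sum.distrib)
  finally have lower: "2 * n * m \<le> 4 * N - 3 / 2 * R + 1 / 2 * Q" .
  define k where "k = n * m"
  have k: "0 < k"
    using pos by (simp add: k_def)
  have balanced: "3 / 2 * (X + Y) \<le> 4 * N - 2 * k + 2 * t"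
  proof -
    have "2 * k \<le> 4 * N - 3 / 2 * R + 1 / 2 * Q"
      using lower by (simp add: k_def mult.assoc)
    then show ?thesis
      using deficit product by argo
  qed
  define x where "x = N / k"
  have N: "N = x * k" and T: "T = t * k"
    using pos by (simp_all add: x_def t_def k_def)
  have "k * (2 * N - (X + Y) + 2 * t) \<le> k * (3 * x * N)"
    using pair unfolding k_def[symmetric] by (simp add: T N power2_eq_square algebra_simps)
  then have "2 * N - (X + Y) + 2 * t \<le> 3 * (x * N)"
    using k by (simp add: mult_le_cancel_left_pos)
  then have "0 \<le> 9 / 2 * (x * N) + N - 2 * k - t"
    using balanced by argo
  moreover have "0 \<le> t"
    using T_nonneg pos by (simp add: t_def)
  ultimately have "0 \<le> 9 / 2 * (x * N) + N - 2 * k"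
    by linarith
  then have "0 \<le> (9 / 2 * x\<^sup>2 + x - 2) * k"
    by (simp add: N power2_eq_square algebra_simps)
  then have "0 \<le> 9 / 2 * x\<^sup>2 + x - 2"
    using k by (simp add: zero_le_mult_iff)
  moreover have "0 \<le> x"
    using k by (simp add: x_def N_def)
  ultimately have "(5 + sqrt 73) / 24 \<le> x"
    by (intro constant_le_if_quadratic_nonneg)
  then have "(5 + sqrt 73) / 24 * k \<le> N"
    using k unfolding N by (intro mult_right_mono) auto
  then show ?thesis
    by (simp add: N_def k_def mult.assoc)
qed

theorem theorem1p3:
  fixes G :: "'a pair_pre_digraph" and H :: "'b pair_pre_digraph"
  assumes "pair_graph G" and "pverts G \<noteq> {}"
    and "pair_graph H" and "pverts H \<noteq> {}"
  shows "real (domination_number (cartesian_product G H))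
           \<ge> (5 + sqrt 73) / 24 * real (domination_number G) * real (domination_number H)"
proof -
  obtain D where "dominating_set (cartesian_product G H) D"
      and "card D = domination_number (cartesian_product G H)"
    by (rule obtain_minimum_dominating_set)
  then show ?thesis
    using card_product_dominating_ge[OF assms(1,3) product_dominating_if_dominating_set] by metis
qed

end
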